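(* Let $\{(Q_\lambda,\ast_\lambda)\}_{\lambda=1,\ldots,n}$ be a finite family of nontrivial connected quandles and let $(\prod_{\lambda=1}^nQ_\lambda,\ast)$ denote their direct product. Then there is a canonical bijection $$\operatorname{Good}\Bigl(\prod_{\lambda=1}^nQ_\lambda\Bigr)\;\cong\;\prod_{\lambda=1}^n\operatorname{Good}(Q_\lambda,\ast_\lambda),$$ namely the one under which $(\rho_\lambda)_\lambda\in\prod_{\lambda=1}^n\operatorname{Good}(Q_\lambda,\ast_\lambda)$ corresponds to the componentwise map $(x_\lambda)_\lambda\mapsto(\rho_\lambda(x_\lambda))_\lambda$.
   Context: A quandle is a set $Q$ with a binary operation $\ast$ such that: (1) $x\ast x=x$ for all $x$; (2) for every $y\in Q$ the map $s_y\colon Q\to Q$, $s_y(x)=x\ast y$, is invertible; (3) $(x\ast y)\ast z=(x\ast z)\ast(y\ast z)$ for all $x,y,z$. Write $x\ast^{-1}y:=s_y^{-1}(x)$. A quandle is trivial if $x\ast y=x$ for all $x,y$, and nontrivial otherwise. A quandle is connected if its inner automorphism group, the group of bijections of $Q$ generated by $\{s_y\mid y\in Q\}$, acts transitively on $Q$. A good involution on $(Q,\ast)$ is a map $\rho\colon Q\to Q$ with $\rho\circ\rho=\mathrm{id}_Q$, $\rho(x\ast y)=\rho(x)\ast y$ and $x\ast\rho(y)=x\ast^{-1}y$ for all $x,y\in Q$; $\operatorname{Good}(Q,\ast)$ is the set of good involutions. The direct product of quandles is the Cartesian product with the componentwise operation $(x_\lambda)_\lambda\ast(y_\lambda)_\lambda=(x_\lambda\ast_\lambda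 y_\lambda)_\lambda$. *)

theory Defs
  imports "HOL-Algebra.Algebra"
begin

record 'a quandle_struct = "'a partial_object" +
  qop :: "'a \<Rightarrow> 'a \<Rightarrow> 'a" (infixl "\<star>\<index>" 70)

text \<open>
  The right translation \<open>s\<^sub>y\<close>.  It is extensional (undefined off the carrier), as required of
  the elements of \<^const>\<open>BijGroup\<close>.
\<close>

definition rtrans :: "('a, 'b) quandle_struct_scheme \<Rightarrow> 'a \<Rightarrow> 'a \<Rightarrow> 'a" where
  "rtrans Q y = (\<lambda>x\<in>carrier Q. x \<star>\<^bsub>Q\<^esub> y)"

locale quandle =
  fixes Q (structure)
  assumes qop_closed: "\<lbrakk>x \<in> carrier Q; y \<in> carrier Q\<rbrakk> \<Longrightarrow> x \<star> y \<in> carrier Q"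
    and qop_idem: "x \<in> carrier Q \<Longrightarrow> x \<star> x = x"
    and rtrans_bij: "y \<in> carrier Q \<Longrightarrow> bij_betw (rtrans Q y) (carrier Q) (carrier Q)"
    and qop_distrib:
      "\<lbrakk>x \<in> carrier Q; y \<in> carrier Q; z \<in> carrier Q\<rbrakk>
        \<Longrightarrow> (x \<star> y) \<star> z = (x \<star> z) \<star> (y \<star> z)"

definition qop_inv :: "('a, 'b) quandle_struct_scheme \<Rightarrow> 'a \<Rightarrow> 'a \<Rightarrow> 'a" where
  "qop_inv Q x y = inv_into (carrier Q) (rtrans Q y) x"

definition trivial_quandle :: "('a, 'b) quandle_struct_scheme \<Rightarrow> bool" where
  "trivial_quandle Q \<longleftrightarrow> (\<forall>x\<in>carrier Q. \<forall>y\<in>carrier Q. x \<star>\<^bsub>Q\<^esub> y = x)"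

definition inn_group :: "('a, 'b) quandle_struct_scheme \<Rightarrow> ('a \<Rightarrow> 'a) monoid" where
  "inn_group Q = (BijGroup (carrier Q))
     \<lparr>carrier := generate (BijGroup (carrier Q)) (rtrans Q ` carrier Q)\<rparr>"

definition connected_quandle :: "('a, 'b) quandle_struct_scheme \<Rightarrow> bool" where
  "connected_quandle Q \<longleftrightarrow> transitive_action (inn_group Q) (carrier Q) (\<lambda>g. g)"

text \<open>
  Self-maps of a quandle are represented by extensional functions, so that two good involutions
  are equal exactly when they agree on the carrier.
\<close>

definition Good :: "('a, 'b) quandle_struct_scheme \<Rightarrow> ('a \<Rightarrow> 'a) set" where
  "Good Q = {\<rho> \<in> carrier Q \<rightarrow>\<^sub>E carrier Q.
     (\<forall>x\<in>carrier Q. \<rho> (\<rho> x) = x) \<and>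
     (\<forall>x\<in>carrier Q. \<forall>y\<in>carrier Q. \<rho> (x \<star>\<^bsub>Q\<^esub> y) = \<rho> x \<star>\<^bsub>Q\<^esub> y) \<and>
     (\<forall>x\<in>carrier Q. \<forall>y\<in>carrier Q. x \<star>\<^bsub>Q\<^esub> \<rho> y = qop_inv Q x y)}"

definition product_quandle ::
  "'i set \<Rightarrow> ('i \<Rightarrow> ('a, 'b) quandle_struct_scheme) \<Rightarrow> ('i \<Rightarrow> 'a) quandle_struct" where
  "product_quandle I Q =
     \<lparr>carrier = (\<Pi>\<^sub>E i\<in>I. carrier (Q i)), qop = (\<lambda>x y. \<lambda>i\<in>I. x i \<star>\<^bsub>Q i\<^esub> y i)\<rparr>"

definition componentwise_map ::
  "'i set \<Rightarrow> ('i \<Rightarrow> ('a, 'b) quandle_struct_scheme) \<Rightarrow> ('i \<Rightarrow> 'a \<Rightarrow> 'a) \<Rightarrow> ('i \<Rightarrow> 'a) \<Rightarrow> ('i \<Rightarrow> 'a)"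
  where
  "componentwise_map I Q \<rho> = (\<lambda>x\<in>carrier (product_quandle I Q). \<lambda>i\<in>I. \<rho> i (x i))"

text \<open>
  Two checks of the encoding: for a quandle, \<^const>\<open>connected_quandle\<close> amounts to transitivity
  alone (the group action part is automatic), and the direct product of quandles is a quandle.
\<close>

lemma (in quandle) connected_quandle_iff:
  "connected_quandle Q \<longleftrightarrow>
    (\<forall>x\<in>carrier Q. \<forall>y\<in>carrier Q.
       \<exists>g\<in>generate (BijGroup (carrier Q)) (rtrans Q ` carrier Q). g x = y)"
proof -
  let ?B = "BijGroup (carrier Q)"
  interpret B: group ?B by (rule group_BijGroup)
  have sub: "rtrans Q ` carrier Q \<subseteq> carrier ?B"
    using rtrans_bij by (auto simp: BijGroup_def Bij_def rtrans_def)
  have sg: "subgroup (generate ?B (rtrans Q ` carrier Q)) ?B"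
    by (rule B.generate_is_subgroup[OF sub])
  have "group (inn_group Q)"
    unfolding inn_group_def by (rule B.subgroup_imp_group[OF sg])
  moreover have "(\<lambda>g. g) \<in> hom (inn_group Q) ?B"
    using subgroup.subset[OF sg] by (auto simp: hom_def inn_group_def)
  ultimately have "group_action (inn_group Q) (carrier Q) (\<lambda>g. g)"
    by (simp add: group_action_def group_hom_def group_hom_axioms_def group_BijGroup)
  then show ?thesis
    by (auto simp: connected_quandle_def transitive_action_def transitive_action_axioms_def
        inn_group_def)
qed

lemma quandle_product_quandle:
  assumes "\<And>i. i \<in> I \<Longrightarrow> quandle (Q i)"
  shows "quandle (product_quandle I Q)"
proof
  let ?P = "product_quandle I Q"
  fix x y z
  assume x: "x \<in> carrier ?P"
  show "x \<star>\<^bsub>?P\<^esub> x = x"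
    using x assms by (auto simp: product_quandle_def quandle.qop_idem fun_eq_iff PiE_iff extensional_def)
  assume y: "y \<in> carrier ?P"
  show "x \<star>\<^bsub>?P\<^esub> y \<in> carrier ?P"
    using x y assms by (auto simp: product_quandle_def PiE_iff intro!: quandle.qop_closed)
  assume z: "z \<in> carrier ?P"
  show "x \<star>\<^bsub>?P\<^esub> y \<star>\<^bsub>?P\<^esub> z = x \<star>\<^bsub>?P\<^esub> z \<star>\<^bsub>?P\<^esub> (y \<star>\<^bsub>?P\<^esub> z)"
    using x y z assms
    by (auto simp: product_quandle_def PiE_iff fun_eq_iff intro!: quandle.qop_distrib)
next
  let ?P = "product_quandle I Q"
  fix y assume y: "y \<in> carrier ?P"
  then have yi: "y i \<in> carrier (Q i)" if "i \<in> I" for i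
    using that by (auto simp: product_quandle_def)
  have b: "bij_betw (rtrans (Q i) (y i)) (carrier (Q i)) (carrier (Q i))" if "i \<in> I" for i
    using quandle.rtrans_bij[OF assms[OF that] yi[OF that]] .
  have eq: "rtrans ?P y x = (\<lambda>i\<in>I. rtrans (Q i) (y i) (x i))" if "x \<in> carrier ?P" for x
    using that by (auto simp: rtrans_def product_quandle_def fun_eq_iff)
  show "bij_betw (rtrans ?P y) (carrier ?P) (carrier ?P)"
  proof (rule bij_betw_byWitness
      [where f' = "\<lambda>x. \<lambda>i\<in>I. inv_into (carrier (Q i)) (rtrans (Q i) (y i)) (x i)"])
    have ext: "a \<in> extensional I" and ai: "i \<in> I \<Longrightarrow> a i \<in> carrier (Q i)"
      if "a \<in> carrier ?P" for a i
      using that by (auto simp: product_quandle_def PiE_iff)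
    show "\<forall>a\<in>carrier ?P. (\<lambda>i\<in>I. inv_into (carrier (Q i)) (rtrans (Q i) (y i))
        (rtrans ?P y a i)) = a"
      by (intro ballI extensionalityI[of _ I])
        (simp_all add: eq ext ai bij_betw_inv_into_left[OF b])
    have inP: "(\<lambda>i\<in>I. inv_into (carrier (Q i)) (rtrans (Q i) (y i)) (a i)) \<in> carrier ?P"
      if "a \<in> carrier ?P" for a
      using that b by (auto simp: product_quandle_def PiE_iff bij_betw_def intro!: inv_into_into)
    show "\<forall>a\<in>carrier ?P. rtrans ?P y
        (\<lambda>i\<in>I. inv_into (carrier (Q i)) (rtrans (Q i) (y i)) (a i)) = a"
      by (intro ballI extensionalityI[of _ I])
        (simp_all add: eq[OF inP] ext ai bij_betw_inv_into_right[OF b])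
    show "(\<lambda>x. \<lambda>i\<in>I. inv_into (carrier (Q i)) (rtrans (Q i) (y i)) (x i)) ` carrier ?P
        \<subseteq> carrier ?P"
      using inP by blast
    have "rtrans ?P y a \<in> carrier ?P" if "a \<in> carrier ?P" for a
      using that b by (subst eq) (auto simp: product_quandle_def PiE_iff bij_betw_def)
    then show "rtrans ?P y ` carrier ?P \<subseteq> carrier ?P"
      by blast
  qed
qed

end

theory Submission
  imports Defs
begin

text \<open>
  A good involution \<open>\<rho>\<close> of any quandle satisfies \<open>\<rho> x \<star> x = \<rho> x\<close>, because
  \<open>\<rho> x = \<rho> x \<star> \<rho> x\<close> and translation by \<open>\<rho> x\<close> is inverse to translation by \<open>x\<close>.  In a product this
  makes the component \<open>\<rho> x i\<close> blind to the coordinates of \<open>x\<close> other than \<open>i\<close>.  Indeed, by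
  idempotency, replacing a coordinate \<open>x j\<close> by \<open>x j \<star> y\<close> is the translation of \<open>x\<close> by \<open>x(j := y)\<close>;
  \<open>\<rho>\<close> commutes with this translation, so for \<open>i \<noteq> j\<close> the component \<open>\<rho> x i\<close> becomes
  \<open>\<rho> x i \<star> x i = \<rho> x i\<close>.  As the factor \<open>j\<close> is connected, such replacements, together with their
  inverses, reach every value of the coordinate \<open>j\<close>; and as there are finitely many factors, any two
  points that agree at \<open>i\<close> are joined by changing one coordinate at a time
  (\<open>Good_product_component\<close>).

  So \<open>\<rho>\<close> is componentwise.  Its components are found by varying one coordinate of a base point,
  which is where nonempty factors are needed: with an empty factor, the product has just one good
  involution whatever the other factors are.  Nontriviality of a quandle gives nonemptiness.
  That the components are good involutions, and that componentwise maps of good involutions are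
  good, is then read off coordinate by coordinate.
\<close>

section \<open>Good involutions of a quandle\<close>

lemma (in quandle) qop_inv_eq_iff:
  assumes "x \<in> carrier Q" "y \<in> carrier Q" "z \<in> carrier Q"
  shows "z = qop_inv Q x y \<longleftrightarrow> z \<star> y = x"
proof -
  note b = rtrans_bij[OF assms(2)]
  have r: "rtrans Q y z = z \<star> y" using assms by (simp add: rtrans_def)
  show ?thesis
  proof
    assume "z = qop_inv Q x y"
    then show "z \<star> y = x"
      using bij_betw_inv_into_right[OF b assms(1)] r by (simp add: qop_inv_def)
  next
    assume "z \<star> y = x"
    then show "z = qop_inv Q x y"
      using bij_betw_inv_into_left[OF b assms(3)] r by (simp add: qop_inv_def)
  qed
qed

text \<open>
  Without the inverse operation, the laws are equations in \<open>\<star>\<close> and \<open>\<rho>\<close>, so for a componentwise map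
  on a product they can be checked one coordinate at a time.
\<close>

lemma (in quandle) Good_iff:
  "\<rho> \<in> Good Q \<longleftrightarrow> \<rho> \<in> carrier Q \<rightarrow>\<^sub>E carrier Q \<and>
     (\<forall>x\<in>carrier Q. \<rho> (\<rho> x) = x) \<and>
     (\<forall>x\<in>carrier Q. \<forall>y\<in>carrier Q. \<rho> (x \<star> y) = \<rho> x \<star> y) \<and>
     (\<forall>x\<in>carrier Q. \<forall>y\<in>carrier Q. (x \<star> \<rho> y) \<star> y = x)"
proof (cases "\<rho> \<in> carrier Q \<rightarrow>\<^sub>E carrier Q")
  case True
  have "x \<star> \<rho> y = qop_inv Q x y \<longleftrightarrow> (x \<star> \<rho> y) \<star> y = x"
    if "x \<in> carrier Q" "y \<in> carrier Q" for x y
    using that True by (intro qop_inv_eq_iff qop_closed) auto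
  then show ?thesis by (simp add: Good_def)
qed (simp add: Good_def)

lemma (in quandle) Good_absorb:
  assumes "\<rho> \<in> Good Q" "x \<in> carrier Q"
  shows "\<rho> x \<star> x = \<rho> x"
proof -
  have "\<rho> x \<in> carrier Q" using assms by (auto simp: Good_iff)
  then have "(\<rho> x \<star> \<rho> x) \<star> x = \<rho> x" using assms by (auto simp: Good_iff)
  then show ?thesis using qop_idem[OF \<open>\<rho> x \<in> carrier Q\<close>] by simp
qed

section \<open>Invariant functions on a connected quandle\<close>

text \<open>
  Invariance under the translations passes to the group that they generate; an inverse translation
  is undone by applying the hypothesis at its image.
\<close>

lemma (in quandle) connected_invariant_constant:
  assumes conn: "connected_quandle Q"
    and inv: "\<And>x y. \<lbrakk>x \<in> carrier Q; y \<in> carrier Q\<rbrakk> \<Longrightarrow> f (x \<star> y) = f x"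
    and ab: "a \<in> carrier Q" "b \<in> carrier Q"
  shows "f a = f b"
proof -
  let ?B = "BijGroup (carrier Q)"
  have Bij: "rtrans Q y \<in> Bij (carrier Q)" if "y \<in> carrier Q" for y
    using rtrans_bij[OF that] by (simp add: Bij_def rtrans_def)
  obtain g where g: "g \<in> generate ?B (rtrans Q ` carrier Q)" and "g a = b"
    using conn ab by (auto simp: connected_quandle_iff)
  from g have "g \<in> Bij (carrier Q) \<and> (\<forall>x\<in>carrier Q. f (g x) = f x)"
  proof (induction rule: generate.induct)
    case one
    then show ?case using id_Bij[of "carrier Q"] by (simp add: BijGroup_def restrict_def)
  next
    case (incl h)
    then show ?case using Bij inv by (auto simp: rtrans_def)
  next
    case (inv h)
    then obtain y where y: "y \<in> carrier Q" "h = rtrans Q y" by auto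
    let ?k = "\<lambda>x\<in>carrier Q. inv_into (carrier Q) h x"
    have k: "inv\<^bsub>?B\<^esub> h = ?k" using inv_BijGroup[OF Bij[OF y(1)]] y by simp
    have b: "bij_betw h (carrier Q) (carrier Q)" using rtrans_bij y by simp
    have "f (?k x) = f x" if x: "x \<in> carrier Q" for x
    proof -
      have "?k x \<in> carrier Q"
        using b x by (auto simp: bij_betw_def intro: inv_into_into)
      moreover from this have "?k x \<star> y = x"
        using bij_betw_inv_into_right[OF b x] x y by (simp add: rtrans_def)
      ultimately show ?thesis using assms(2)[of "?k x" y] y by simp
    qed
    moreover have "?k \<in> Bij (carrier Q)"
      using restrict_inv_into_Bij[OF Bij[OF y(1)]] y(2) by simp
    ultimately show ?case unfolding k by blast
  next
    case (eng h1 h2)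
    then have "h2 x \<in> carrier Q" if "x \<in> carrier Q" for x
      using that Bij_imp_funcset by blast
    then show ?case using eng by (auto simp: BijGroup_def compose_Bij) (simp add: compose_def)
  qed
  then show ?thesis using \<open>g a = b\<close> ab by auto
qed

section \<open>Good involutions of a product\<close>

lemma carrier_product: "carrier (product_quandle I Q) = (\<Pi>\<^sub>E i\<in>I. carrier (Q i))"
  by (simp add: product_quandle_def)

lemma qop_product: "x \<star>\<^bsub>product_quandle I Q\<^esub> y = (\<lambda>i\<in>I. x i \<star>\<^bsub>Q i\<^esub> y i)"
  by (simp add: product_quandle_def)

lemma Good_product_coordinate_change:
  assumes q: "\<And>i. i \<in> I \<Longrightarrow> quandle (Q i)"
    and "connected_quandle (Q j)" "i \<in> I" "j \<in> I" "i \<noteq> j"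
    and \<rho>: "\<rho> \<in> Good (product_quandle I Q)"
    and x: "x \<in> carrier (product_quandle I Q)" and c: "c \<in> carrier (Q j)"
  shows "\<rho> (x(j := c)) i = \<rho> x i"
proof -
  let ?P = "product_quandle I Q"
  interpret P: quandle ?P using q by (rule quandle_product_quandle)
  have upd: "x(j := a) \<in> carrier ?P" if "a \<in> carrier (Q j)" for a
    using x that \<open>j \<in> I\<close> by (auto simp: carrier_product PiE_iff extensional_def)
  have xj: "x j \<in> carrier (Q j)" using x \<open>j \<in> I\<close> by (auto simp: carrier_product)
  have "\<rho> (x(j := c)) i = \<rho> (x(j := x j)) i"
  proof (rule quandle.connected_invariant_constant[OF q[OF \<open>j \<in> I\<close>] assms(2) _ c xj])
    fix a b assume ab: "a \<in> carrier (Q j)" "b \<in> carrier (Q j)"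
    let ?u = "x(j := a)" and ?v = "x(j := b)"
    have "?u \<star>\<^bsub>?P\<^esub> ?v = x(j := a \<star>\<^bsub>Q j\<^esub> b)"
      using x \<open>j \<in> I\<close> q
      by (auto simp: qop_product carrier_product fun_eq_iff PiE_iff extensional_def
          quandle.qop_idem)
    then have "\<rho> (x(j := a \<star>\<^bsub>Q j\<^esub> b)) = \<rho> ?u \<star>\<^bsub>?P\<^esub> ?v"
      using \<rho> upd ab by (metis P.Good_iff)
    then have "\<rho> (x(j := a \<star>\<^bsub>Q j\<^esub> b)) i = \<rho> ?u i \<star>\<^bsub>Q i\<^esub> x i"
      using \<open>i \<in> I\<close> \<open>i \<noteq> j\<close> by (simp add: qop_product)
    also have "\<dots> = (\<rho> ?u \<star>\<^bsub>?P\<^esub> ?u) i"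
      using \<open>i \<in> I\<close> \<open>i \<noteq> j\<close> by (simp add: qop_product)
    also have "\<dots> = \<rho> ?u i"
      using P.Good_absorb[OF \<rho> upd[OF ab(1)]] by simp
    finally show "\<rho> (x(j := a \<star>\<^bsub>Q j\<^esub> b)) i = \<rho> ?u i" .
  qed
  then show ?thesis by simp
qed

text \<open>
  The two points are joined through the points that agree with \<open>y\<close> on a growing finite set of
  coordinates and with \<open>x\<close> elsewhere.
\<close>

lemma Good_product_component:
  assumes "finite I"
    and q: "\<And>i. i \<in> I \<Longrightarrow> quandle (Q i)"
    and conn: "\<And>i. i \<in> I \<Longrightarrow> connected_quandle (Q i)"
    and "i \<in> I"
    and \<rho>: "\<rho> \<in> Good (product_quandle I Q)"
    and x: "x \<in> carrier (product_quandle I Q)" and y: "y \<in> carrier (product_quandle I Q)"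
    and "x i = y i"
  shows "\<rho> x i = \<rho> y i"
proof -
  let ?m = "\<lambda>J k. if k \<in> J then y k else x k"
  have m: "?m J \<in> carrier (product_quandle I Q)" for J
    using x y by (auto simp: carrier_product PiE_iff extensional_def)
  have "\<rho> (?m J) i = \<rho> x i" if "finite J" "J \<subseteq> I" for J
    using that
  proof (induction J rule: finite_induct)
    case (insert j J)
    show ?case
    proof (cases "i = j")
      case True
      then have "?m (insert j J) = ?m J" using \<open>x i = y i\<close> by auto
      then show ?thesis using insert by simp
    next
      case False
      have "?m (insert j J) = (?m J)(j := y j)" by auto
      moreover have "\<rho> ((?m J)(j := y j)) i = \<rho> (?m J) i"
        using insert.prems y q conn \<open>i \<in> I\<close> False \<rho>
        by (intro Good_product_coordinate_change[where I = I and Q = Q] m)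
          (auto simp: carrier_product)
      ultimately show ?thesis using insert by simp
    qed
  qed simp
  moreover have "?m I = y"
    using x y by (auto simp: carrier_product PiE_iff extensional_def)
  ultimately show ?thesis using \<open>finite I\<close> by force
qed

section \<open>The bijection\<close>

lemma componentwise_map_apply:
  "\<lbrakk>x \<in> carrier (product_quandle I Q); i \<in> I\<rbrakk> \<Longrightarrow> componentwise_map I Q \<rho> x i = \<rho> i (x i)"
  by (simp add: componentwise_map_def)

lemma componentwise_map_Good:
  assumes q: "\<And>i. i \<in> I \<Longrightarrow> quandle (Q i)"
    and \<rho>: "\<rho> \<in> (\<Pi>\<^sub>E i\<in>I. Good (Q i))"
  shows "componentwise_map I Q \<rho> \<in> Good (product_quandle I Q)"
proof -
  let ?P = "product_quandle I Q" and ?F = "componentwise_map I Q \<rho>"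
  interpret P: quandle ?P using q by (rule quandle_product_quandle)
  have G: "\<rho> i \<in> Good (Q i)" if "i \<in> I" for i using \<rho> that by auto
  note G' = quandle.Good_iff[OF q, THEN iffD1, OF _ G]
  have val: "?F x = (\<lambda>i\<in>I. \<rho> i (x i))" if "x \<in> carrier ?P" for x
    using that by (simp add: componentwise_map_def)
  have cl: "?F x \<in> carrier ?P" if "x \<in> carrier ?P" for x
    using that G' by (auto simp: val) (auto simp: carrier_product PiE_iff)
  have comp: "x i \<in> carrier (Q i)" if "x \<in> carrier ?P" "i \<in> I" for x i
    using that by (auto simp: carrier_product)
  have ext: "x \<in> extensional I" if "x \<in> carrier ?P" for x
    using that by (auto simp: carrier_product PiE_iff)
  show ?thesis
    unfolding P.Good_iff
  proof (intro conjI ballI)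
    show "?F \<in> carrier ?P \<rightarrow>\<^sub>E carrier ?P"
      using cl by (auto simp: PiE_iff componentwise_map_def)
    fix x assume x: "x \<in> carrier ?P"
    show "?F (?F x) = x"
      unfolding val[OF cl[OF x]] unfolding val[OF x]
      using G' comp[OF x] ext[OF x]
      by (intro extensionalityI[of _ I]) auto
    fix y assume y: "y \<in> carrier ?P"
    show "?F (x \<star>\<^bsub>?P\<^esub> y) = ?F x \<star>\<^bsub>?P\<^esub> y"
      unfolding val[OF P.qop_closed[OF x y]] val[OF x]
      using G' comp[OF x] comp[OF y] by (auto simp: qop_product fun_eq_iff)
    show "x \<star>\<^bsub>?P\<^esub> ?F y \<star>\<^bsub>?P\<^esub> y = x"
      using G' comp[OF x] comp[OF y] ext[OF x] y
      by (intro extensionalityI[of _ I]) (auto simp: val qop_product)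
  qed
qed

lemma componentwise_map_inj:
  assumes ne: "\<And>i. i \<in> I \<Longrightarrow> carrier (Q i) \<noteq> {}"
  shows "inj_on (componentwise_map I Q) (\<Pi>\<^sub>E i\<in>I. Good (Q i))"
proof (rule inj_onI, rule PiE_ext)
  fix \<rho> \<sigma> i
  assume \<rho>: "\<rho> \<in> (\<Pi>\<^sub>E i\<in>I. Good (Q i))" and \<sigma>: "\<sigma> \<in> (\<Pi>\<^sub>E i\<in>I. Good (Q i))"
    and eq: "componentwise_map I Q \<rho> = componentwise_map I Q \<sigma>" and i: "i \<in> I"
  obtain b where b: "b \<in> carrier (product_quandle I Q)"
    using ne PiE_eq_empty_iff[of I "\<lambda>i. carrier (Q i)"] unfolding carrier_product by blast
  have "\<rho> i \<in> Good (Q i)" "\<sigma> i \<in> Good (Q i)"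
    using \<rho> \<sigma> i by auto
  then have "\<rho> i \<in> extensional (carrier (Q i))" "\<sigma> i \<in> extensional (carrier (Q i))"
    by (auto simp: Good_def PiE_iff)
  then show "\<rho> i = \<sigma> i"
  proof (rule extensionalityI)
    fix a assume "a \<in> carrier (Q i)"
    then have "b(i := a) \<in> carrier (product_quandle I Q)"
      using b i by (auto simp: carrier_product PiE_iff extensional_def)
    then show "\<rho> i a = \<sigma> i a"
      using componentwise_map_apply[of "b(i := a)" I Q i] i eq by (metis fun_upd_same)
  qed
qed

lemma componentwise_map_surj:
  assumes "finite I"
    and q: "\<And>i. i \<in> I \<Longrightarrow> quandle (Q i)"
    and ne: "\<And>i. i \<in> I \<Longrightarrow> carrier (Q i) \<noteq> {}"
    and conn: "\<And>i. i \<in> I \<Longrightarrow> connected_quandle (Q i)"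
    and \<rho>: "\<rho> \<in> Good (product_quandle I Q)"
  shows "\<exists>\<sigma>\<in>(\<Pi>\<^sub>E i\<in>I. Good (Q i)). componentwise_map I Q \<sigma> = \<rho>"
proof -
  let ?P = "product_quandle I Q"
  interpret P: quandle ?P using q by (rule quandle_product_quandle)
  obtain b where b: "b \<in> carrier ?P"
    using ne PiE_eq_empty_iff[of I "\<lambda>i. carrier (Q i)"] unfolding carrier_product by blast
  have upd: "b(i := a) \<in> carrier ?P" if "i \<in> I" "a \<in> carrier (Q i)" for i a
    using b that by (auto simp: carrier_product PiE_iff extensional_def)
  have \<rho>P: "\<rho> x \<in> carrier ?P" if "x \<in> carrier ?P" for x
    using \<rho> that by (auto simp: P.Good_iff)
  define \<sigma> where "\<sigma> = (\<lambda>i\<in>I. \<lambda>a\<in>carrier (Q i). \<rho> (b(i := a)) i)"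
  have comp: "x i \<in> carrier (Q i)" if "x \<in> carrier ?P" "i \<in> I" for x i
    using that by (auto simp: carrier_product)
  have \<sigma>: "\<sigma> i (x i) = \<rho> x i" if "x \<in> carrier ?P" "i \<in> I" for x i
  proof -
    have "\<rho> (b(i := x i)) i = \<rho> x i"
      using that comp upd
      by (intro Good_product_component[OF \<open>finite I\<close> q conn _ \<rho>]) auto
    then show ?thesis using that comp by (simp add: \<sigma>_def)
  qed
  have "\<sigma> i \<in> Good (Q i)" if i: "i \<in> I" for i
  proof -
    interpret Qi: quandle "Q i" using q i .
    \<comment> \<open>Each law of \<open>\<sigma> i\<close> at \<open>a\<close>, \<open>c\<close> is the \<open>i\<close>-th coordinate of the same law of \<open>\<rho>\<close> at
      \<open>?e a\<close>, \<open>?e c\<close>.\<close>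
    let ?e = "\<lambda>a. b(i := a)"
    have \<sigma>e: "\<sigma> i a = \<rho> (?e a) i" if "a \<in> carrier (Q i)" for a
      using that i by (simp add: \<sigma>_def)
    show ?thesis
      unfolding Qi.Good_iff
    proof (intro conjI ballI)
      show "\<sigma> i \<in> carrier (Q i) \<rightarrow>\<^sub>E carrier (Q i)"
        using i \<rho>P upd comp by (auto simp: \<sigma>_def)
      fix a assume a: "a \<in> carrier (Q i)"
      note ea = upd[OF i a]
      have "\<sigma> i (\<sigma> i a) = \<rho> (\<rho> (?e a)) i"
        using \<sigma>[OF \<rho>P[OF ea] i] \<sigma>e[OF a] by simp
      then show "\<sigma> i (\<sigma> i a) = a"
        using \<rho> ea by (auto simp: P.Good_iff)
      fix c assume c: "c \<in> carrier (Q i)"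
      note ec = upd[OF i c]
      have "\<sigma> i (a \<star>\<^bsub>Q i\<^esub> c) = \<rho> (?e a \<star>\<^bsub>?P\<^esub> ?e c) i"
        using \<sigma>[OF P.qop_closed[OF ea ec] i] i by (simp add: qop_product)
      also have "\<dots> = (\<rho> (?e a) \<star>\<^bsub>?P\<^esub> ?e c) i"
        using \<rho> ea ec by (auto simp: P.Good_iff)
      also have "\<dots> = \<sigma> i a \<star>\<^bsub>Q i\<^esub> c"
        using i \<sigma>e[OF a] by (simp add: qop_product)
      finally show "\<sigma> i (a \<star>\<^bsub>Q i\<^esub> c) = \<sigma> i a \<star>\<^bsub>Q i\<^esub> c" .
      have "a \<star>\<^bsub>Q i\<^esub> \<sigma> i c \<star>\<^bsub>Q i\<^esub> c = (?e a \<star>\<^bsub>?P\<^esub> \<rho> (?e c) \<star>\<^bsub>?P\<^esub> ?e c) i"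
        using i \<sigma>e[OF c] by (simp add: qop_product)
      also have "?e a \<star>\<^bsub>?P\<^esub> \<rho> (?e c) \<star>\<^bsub>?P\<^esub> ?e c = ?e a"
        using \<rho> ea ec by (auto simp: P.Good_iff)
      finally show "a \<star>\<^bsub>Q i\<^esub> \<sigma> i c \<star>\<^bsub>Q i\<^esub> c = a" by simp
    qed
  qed
  then have "\<sigma> \<in> (\<Pi>\<^sub>E i\<in>I. Good (Q i))" by (auto simp: \<sigma>_def)
  moreover have "componentwise_map I Q \<sigma> = \<rho>"
  proof (rule extensionalityI[of _ "carrier ?P"])
    show "componentwise_map I Q \<sigma> \<in> extensional (carrier ?P)"
      by (simp add: componentwise_map_def)
    show "\<rho> \<in> extensional (carrier ?P)" using \<rho> by (auto simp: Good_def PiE_iff)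
    fix x assume x: "x \<in> carrier ?P"
    show "componentwise_map I Q \<sigma> x = \<rho> x"
    proof (rule extensionalityI[of _ I])
      show "componentwise_map I Q \<sigma> x \<in> extensional I"
        using x by (simp add: componentwise_map_def)
      show "\<rho> x \<in> extensional I" using \<rho>P[OF x] by (auto simp: carrier_product PiE_iff)
    qed (simp add: componentwise_map_apply x \<sigma>)
  qed
  ultimately show ?thesis by blast
qed

theorem theorem1p4:
  fixes n :: nat and Q :: "nat \<Rightarrow> 'a quandle_struct"
  assumes "\<And>i. i \<in> {1..n} \<Longrightarrow> quandle (Q i)"
    and "\<And>i. i \<in> {1..n} \<Longrightarrow> \<not> trivial_quandle (Q i)"
    and "\<And>i. i \<in> {1..n} \<Longrightarrow> connected_quandle (Q i)"
  shows "bij_betw (componentwise_map {1..n} Q)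
           (\<Pi>\<^sub>E i\<in>{1..n}. Good (Q i)) (Good (product_quandle {1..n} Q))"
proof -
  have ne: "carrier (Q i) \<noteq> {}" if "i \<in> {1..n}" for i
    using assms(2)[OF that] by (auto simp: trivial_quandle_def)
  have "componentwise_map {1..n} Q ` (\<Pi>\<^sub>E i\<in>{1..n}. Good (Q i)) = Good (product_quandle {1..n} Q)"
  proof
    show "componentwise_map {1..n} Q ` (\<Pi>\<^sub>E i\<in>{1..n}. Good (Q i))
        \<subseteq> Good (product_quandle {1..n} Q)"
      using componentwise_map_Good[of "{1..n}" Q] assms(1) by blast
    show "Good (product_quandle {1..n} Q)
        \<subseteq> componentwise_map {1..n} Q ` (\<Pi>\<^sub>E i\<in>{1..n}. Good (Q i))"
      using componentwise_map_surj[of "{1..n}" Q] assms(1,3) ne by blast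
  qed
  then show ?thesis
    using componentwise_map_inj[of "{1..n}" Q] ne by (simp add: bij_betw_def)
qed

end
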